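(* Let $1/2<\mu\le 1$. The fixed point $h_\mu$ of the contraction $M_\mu$ satisfies the commutation relation $T\circ h_\mu=h_\mu\circ T_\mu$ on $[0,1]$.
   Context: For $1/2<\mu\le 1$, the symmetric tent map $T_\mu:[0,1]\to[0,1]$ is $T_\mu(x)=2\mu x$ if $0\le x\le 1/2$ and $T_\mu(x)=2\mu(1-x)$ if $1/2<x\le 1$; $T=T_1$. Let $\mathcal F$ be the set of all functions $f:[0,1]\to[0,1]$, with the metric of the sup norm $\|f\|_\infty=\sup_{x\in[0,1]}|f(x)|$. The operator $M_\mu:\mathcal F\to\mathcal F$ is defined by $M_\mu f(x)=\tfrac12 f(2\mu x)$ if $0\le x\le 1/2$ and $M_\mu f(x)=1-\tfrac12 f(2\mu(1-x))$ if $1/2<x\le 1$. It is a contraction of the complete metric space $\mathcal F$ with constant $1/2$, and $h_\mu\in\mathcal F$ denotes its unique fixed point. *)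

theory Defs
  imports "HOL-Analysis.Analysis"
begin

definition tent :: "real \<Rightarrow> real \<Rightarrow> real" where
  "tent \<mu> x = (if x \<le> 1/2 then 2 * \<mu> * x else 2 * \<mu> * (1 - x))"

text \<open>
  A function $[0,1] \to [0,1]$ is represented by its extensional representative on \<^term>\<open>{0..1}\<close>
  (value \<^term>\<open>undefined\<close> elsewhere), so that equality in \<open>unit_maps\<close> is equality of functions
  on $[0,1]$ and a fixed point can be unique. The maps \<^term>\<open>tent \<mu>\<close> are total functions
  used only on \<^term>\<open>{0..1}\<close>, which they map into itself.
\<close>

definition unit_maps :: "(real \<Rightarrow> real) set" where
  "unit_maps = {0..1} \<rightarrow>\<^sub>E {0..1}"

text \<open>The sup metric; its carrier is \<open>unit_maps\<close>, see \<open>mspace_sup_metric\<close> below.\<close>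

definition sup_metric :: "(real \<Rightarrow> real) metric" where
  "sup_metric = funspace {0..1} (submetric euclidean_metric {0..1})"

definition tent_op :: "real \<Rightarrow> (real \<Rightarrow> real) \<Rightarrow> real \<Rightarrow> real" where
  "tent_op \<mu> f = (\<lambda>x\<in>{0..1}. if x \<le> 1/2 then 1/2 * f (2 * \<mu> * x)
                               else 1 - 1/2 * f (2 * \<mu> * (1 - x)))"

definition tent_fix :: "real \<Rightarrow> real \<Rightarrow> real" where
  "tent_fix \<mu> = (THE h. h \<in> unit_maps \<and> tent_op \<mu> h = h)"

lemma tent_in_unit:
  assumes "1/2 < \<mu>" "\<mu> \<le> 1" "x \<in> {0..1}"
  shows "tent \<mu> x \<in> {0..1}"
proof -
  have A: "2 * \<mu> * y \<in> {0..1}" if "0 \<le> y" "y \<le> 1/2" for y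
    using mult_mono[of \<mu> 1 y "1/2"] assms that by auto
  show ?thesis
    using A[of x] A[of "1 - x"] assms(3) by (auto simp: tent_def)
qed

lemma mspace_sup_metric: "mspace sup_metric = unit_maps"
proof -
  interpret S: Metric_space "{0..1::real}" dist
    by (simp add: Met_TC.subspace)
  have "S.mbounded A" if "A \<subseteq> {0..1}" for A
  proof -
    have "A \<subseteq> S.mcball 0 1"
      using that by (auto simp: S.mcball_def dist_real_def)
    then show ?thesis
      unfolding S.mbounded_def by blast
  qed
  then show ?thesis
    by (auto simp: sup_metric_def unit_maps_def S.fspace_def PiE_def image_subset_iff_funcset)
qed

lemma mdist_sup_metric:
  assumes "f \<in> unit_maps" "g \<in> unit_maps"
  shows "mdist sup_metric f g = (SUP x\<in>{0..1}. \<bar>f x - g x\<bar>)"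
proof -
  interpret S: Metric_space "{0..1::real}" dist
    by (simp add: Met_TC.subspace)
  show ?thesis
    using assms unfolding mspace_sup_metric[symmetric] sup_metric_def
    by (simp add: S.fdist_def dist_real_def)
qed

lemma mcomplete_sup_metric: "mcomplete_of sup_metric"
proof -
  interpret S: Submetric UNIV dist "{0..1::real}"
    by unfold_locales auto
  have "S.sub.mcomplete"
    by (rule S.closedin_mcomplete_imp_mcomplete) (simp_all add: complete_UNIV)
  then have "mcomplete_of (funspace {0..1} S.sub.Self)"
    by (rule S.sub.mcomplete_funspace)
  then show ?thesis
    by (simp add: sup_metric_def mcomplete_of_def)
qed

lemma tent_op_in_unit_maps:
  assumes "1/2 < \<mu>" "\<mu> \<le> 1" "f \<in> unit_maps"
  shows "tent_op \<mu> f \<in> unit_maps"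
proof -
  have A: "f (tent \<mu> x) \<in> {0..1}" if "x \<in> {0..1}" for x
    using tent_in_unit[OF assms(1,2) that] assms(3) by (auto simp: unit_maps_def)
  show ?thesis
    using A by (fastforce simp: unit_maps_def tent_op_def tent_def)
qed

lemma tent_op_contraction:
  assumes "1/2 < \<mu>" "\<mu> \<le> 1" and f: "f \<in> unit_maps" and g: "g \<in> unit_maps"
  shows "mdist sup_metric (tent_op \<mu> f) (tent_op \<mu> g) \<le> 1/2 * mdist sup_metric f g"
proof -
  have bdd: "bdd_above ((\<lambda>x. \<bar>f x - g x\<bar>) ` {0..1})"
  proof (rule bdd_aboveI2)
    fix x :: real assume "x \<in> {0..1}"
    then have "f x \<in> {0..1}" "g x \<in> {0..1}"
      using f g by (auto simp: unit_maps_def)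
    then show "\<bar>f x - g x\<bar> \<le> 1" by auto
  qed
  have "\<bar>tent_op \<mu> f x - tent_op \<mu> g x\<bar> \<le> 1/2 * (SUP x\<in>{0..1}. \<bar>f x - g x\<bar>)"
    if x: "x \<in> {0..1}" for x
  proof -
    have "\<bar>tent_op \<mu> f x - tent_op \<mu> g x\<bar> = 1/2 * \<bar>f (tent \<mu> x) - g (tent \<mu> x)\<bar>"
    proof -
      have "\<bar>1/2 * a - 1/2 * b\<bar> = 1/2 * \<bar>a - b\<bar>"
        "\<bar>(1 - 1/2 * a) - (1 - 1/2 * b)\<bar> = 1/2 * \<bar>a - b\<bar>" for a b :: real
        by (simp_all add: abs_if)
      then show ?thesis
        using x unfolding tent_op_def tent_def by (simp only: restrict_apply if_True split: if_split) blast
    qed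
    also have "\<dots> \<le> 1/2 * (SUP x\<in>{0..1}. \<bar>f x - g x\<bar>)"
      using cSUP_upper[OF tent_in_unit[OF assms(1,2) x] bdd] by simp
    finally show ?thesis .
  qed
  then have "(SUP x\<in>{0..1}. \<bar>tent_op \<mu> f x - tent_op \<mu> g x\<bar>)
      \<le> 1/2 * (SUP x\<in>{0..1}. \<bar>f x - g x\<bar>)"
    by (intro cSUP_least) auto
  then show ?thesis
    using assms by (simp only: mdist_sup_metric tent_op_in_unit_maps)
qed

lemma tent_op_unique_fixpoint:
  assumes "1/2 < \<mu>" "\<mu> \<le> 1"
  shows "\<exists>!h. h \<in> unit_maps \<and> tent_op \<mu> h = h"
proof -
  interpret F: Metric_space unit_maps "mdist sup_metric"
    using Metric_space_mspace_mdist[of sup_metric] by (simp add: mspace_sup_metric)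
  have "unit_maps \<noteq> {}"
    by (auto simp: unit_maps_def PiE_eq_empty_iff)
  moreover have "F.mcomplete"
    using mcomplete_sup_metric by (simp add: mcomplete_of_def mspace_sup_metric)
  moreover have "tent_op \<mu> \<in> unit_maps \<rightarrow> unit_maps"
    using tent_op_in_unit_maps[OF assms] by blast
  ultimately obtain h where h: "h \<in> unit_maps" "tent_op \<mu> h = h"
    using F.Banach_fixedpoint_thm[of "tent_op \<mu>" "1/2"] tent_op_contraction[OF assms]
    by auto
  have "h' = h" if "h' \<in> unit_maps" "tent_op \<mu> h' = h'" for h'
    using tent_op_contraction[OF assms that(1) h(1)] F.nonneg[of h' h] F.zero[OF that(1) h(1)]
    by (simp add: that h)
  with h show ?thesis by blast
qed

end

theory Submission
  imports Defs
begin

text \<open>Both branches of \<open>tent_op\<close> are sections of the full tent map: T(y/2) = T(1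
  - y/2) = y for y in [0,1]. Hence composing T with the image of any f in \<open>unit_maps\<close>
  gives f composed with \<open>tent \<mu>\<close> (\<open>tent_comp_tent_op\<close>); at the fixed
  point the image is f itself, which is the commutation.\<close>

lemma tent_fix_fixpoint:
  assumes "1/2 < \<mu>" and "\<mu> \<le> 1"
  shows "tent_fix \<mu> \<in> unit_maps" and "tent_op \<mu> (tent_fix \<mu>) = tent_fix \<mu>"
  using theI'[OF tent_op_unique_fixpoint[OF assms]] by (simp_all add: tent_fix_def)

lemma tent_comp_tent_op:
  assumes "1/2 < \<mu>" and "\<mu> \<le> 1" and "f \<in> unit_maps" and "x \<in> {0..1}"
  shows "tent 1 (tent_op \<mu> f x) = f (tent \<mu> x)"
proof -
  have "f (tent \<mu> x) \<in> {0..1}"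
    using tent_in_unit[OF assms(1,2,4)] assms(3) by (auto simp: unit_maps_def)
  moreover have "tent_op \<mu> f x
      = (if x \<le> 1/2 then 1/2 * f (tent \<mu> x) else 1 - 1/2 * f (tent \<mu> x))"
    using assms(4) by (simp add: tent_op_def tent_def)
  \<comment> \<open>The range of \<open>f\<close> puts the first value in [0,1/2] and the second in
    [1/2,1], so each meets the right branch of \<open>tent 1\<close>; at the shared point 1/2 both
    branches give 1.\<close>
  ultimately show ?thesis
    by (auto simp: tent_def[of 1])
qed

theorem theorem2p6:
  fixes \<mu> :: real
  assumes "1/2 < \<mu>" and "\<mu> \<le> 1"
  shows "\<forall>x\<in>{0..1}. (tent 1 \<circ> tent_fix \<mu>) x = (tent_fix \<mu> \<circ> tent \<mu>) x"
  using tent_comp_tent_op[OF assms tent_fix_fixpoint(1)[OF assms]]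
  by (simp add: tent_fix_fixpoint(2)[OF assms])

end
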